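(* Let $T\ge 1$ and let $\pi=\pi_1\pi_2\cdots\pi_T$ be any binary string of length $T$. Then there exists a bijection \[\Psi_\pi:\ \mathrm{IP}\times \mathrm{ALCD}(\pi)\longrightarrow \mathrm{CPP}(\pi)\] which is weight preserving, i.e. for every integer partition $\gamma$ and every arbitrarily labelled cylindric diagram $\mathfrak{d}$ with profile $\pi$, \[ |\Psi_\pi(\gamma,\mathfrak{d})| \;=\; T\,|\gamma| + |\mathfrak{d}|. \]
   Context: Integer partitions are weakly decreasing sequences of non-negative integers that are eventually zero; $|\lambda|$ is the sum of the parts, and $\mathrm{IP}$ denotes the set of all integer partitions. For partitions $\mu,\lambda$, we say $\lambda/\mu$ is a horizontal strip if $\lambda_1\ge\mu_1\ge\lambda_2\ge\mu_2\ge\cdots$. A cylindric plane partition with profile $\pi$ (a binary string of length $T$) is a sequence of partitions $\mathfrak{c}=(\mu^0,\mu^1,\ldots,\mu^T)$ with $\mu^0=\mu^T$ such that for each $1\le k\le T$: if $\pi_k=1$ then $\mu^k/\mu^{k-1}$ is a horizontal strip, and if $\pi_k=0$ then $\mu^{k-1}/\mu^k$ is a horizontal strip. Its weight is $|\mathfrak{c}|=|\mu^1|+|\mu^2|+\cdots+|\mu^T|$. $\mathrm{CPP}(\pi)$ denotes the set of all cylindric plane partitions with profile $\pi$. The boxes of the cylindric diagram with profile $\pi$ are the triples $(i,j,k)$ of integers with $1\le i,j\le T$, $\pi_i=1$, $\pi_j=0$, and $k\ge 0$ if $i<j$, $k\ge 1$ if $i>j$. The cylindric hook length of the box $(i,j,k)$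 is $j-i+kT$ (always a positive integer). An arbitrarily labelled cylindric diagram $\mathfrak{d}$ with profile $\pi$ is an assignment of a non-negative integer label $\mathrm{lab}(b)$ to every box $b$ of the cylindric diagram with profile $\pi$, such that only finitely many labels are non-zero; $\mathrm{ALCD}(\pi)$ denotes the set of all of them. Its weight is $|\mathfrak{d}|=\sum_{b=(i,j,k)}\mathrm{lab}(b)\,(j-i+kT)$. *)

theory Defs
  imports Main
begin

text \<open>An integer partition is a function on \<open>nat\<close> whose value at \<open>n\<close> is the part with
  index \<open>n + 1\<close> in the usual one-based notation.\<close>

definition IP :: "(nat \<Rightarrow> nat) set" where
  "IP = {\<nu>. antimono \<nu> \<and> (\<exists>N. \<forall>n\<ge>N. \<nu> n = 0)}"

definition partition_weight :: "(nat \<Rightarrow> nat) \<Rightarrow> nat" where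
  "partition_weight \<nu> = (\<Sum>n | \<nu> n \<noteq> 0. \<nu> n)"

definition horizontal_strip :: "(nat \<Rightarrow> nat) \<Rightarrow> (nat \<Rightarrow> nat) \<Rightarrow> bool" where
  "horizontal_strip \<nu> \<mu> \<longleftrightarrow> (\<forall>n. \<nu> n \<ge> \<mu> n \<and> \<mu> n \<ge> \<nu> (Suc n))"

text \<open>A profile is a list of booleans, with \<open>True\<close> for \<open>1\<close> and \<open>False\<close> for \<open>0\<close>. Positions in a
  profile are counted from \<open>1\<close>.\<close>

definition profile_bit :: "bool list \<Rightarrow> nat \<Rightarrow> bool" where
  "profile_bit \<pi> k = \<pi> ! (k - 1)"

text \<open>The sequence \<open>\<mu>\<^sup>0, \<dots>, \<mu>\<^sup>T\<close> is a list of length \<open>T + 1\<close>, so that \<open>c ! k\<close> is \<open>\<mu>\<^sup>k\<close>.\<close>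

definition CPP :: "bool list \<Rightarrow> (nat \<Rightarrow> nat) list set" where
  "CPP \<pi> = {c. length c = length \<pi> + 1 \<and> set c \<subseteq> IP \<and> c ! 0 = c ! length \<pi> \<and>
     (\<forall>k\<in>{1..length \<pi>}.
        (profile_bit \<pi> k \<longrightarrow> horizontal_strip (c ! k) (c ! (k - 1))) \<and>
        (\<not> profile_bit \<pi> k \<longrightarrow> horizontal_strip (c ! (k - 1)) (c ! k)))}"

definition CPP_weight :: "bool list \<Rightarrow> (nat \<Rightarrow> nat) list \<Rightarrow> nat" where
  "CPP_weight \<pi> c = (\<Sum>k=1..length \<pi>. partition_weight (c ! k))"

definition boxes :: "bool list \<Rightarrow> (nat \<times> nat \<times> nat) set" where
  "boxes \<pi> = {(i, j, k). i \<in> {1..length \<pi>} \<and> j \<in> {1..length \<pi>} \<and> profile_bit \<pi> i \<and> \<not> profile_bit \<pi> j \<and>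
     (i < j \<longrightarrow> k \<ge> 0) \<and> (i > j \<longrightarrow> k \<ge> 1)}"

text \<open>On boxes the subtraction of natural numbers below does not truncate.\<close>

fun hook_length :: "bool list \<Rightarrow> nat \<times> nat \<times> nat \<Rightarrow> nat" where
  "hook_length \<pi> (i, j, k) = j + k * length \<pi> - i"

lemma int_hook_length:
  assumes "(i, j, k) \<in> boxes \<pi>"
  shows "int (hook_length \<pi> (i, j, k)) = int j - int i + int k * int (length \<pi>)"
    and "hook_length \<pi> (i, j, k) > 0"
proof -
  have ij: "1 \<le> j" "i \<le> length \<pi>" "i \<noteq> j" "j < i \<longrightarrow> 1 \<le> k"
    using assms by (auto simp: boxes_def)
  have "i < j + k * length \<pi>"
  proof (cases "i < j")
    case False
    then have "length \<pi> \<le> k * length \<pi>"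
      using ij by simp
    then show ?thesis
      using ij by linarith
  qed simp
  then show "int (hook_length \<pi> (i, j, k)) = int j - int i + int k * int (length \<pi>)"
    and "hook_length \<pi> (i, j, k) > 0"
    by (simp_all add: of_nat_diff)
qed

text \<open>A labelling of the boxes is represented by its extension by \<open>0\<close> to all triples.\<close>

definition ALCD :: "bool list \<Rightarrow> (nat \<times> nat \<times> nat \<Rightarrow> nat) set" where
  "ALCD \<pi> = {lab. finite {b. lab b \<noteq> 0} \<and> (\<forall>b. b \<notin> boxes \<pi> \<longrightarrow> lab b = 0)}"

definition ALCD_weight :: "bool list \<Rightarrow> (nat \<times> nat \<times> nat \<Rightarrow> nat) \<Rightarrow> nat" where
  "ALCD_weight \<pi> lab = (\<Sum>b | b \<in> boxes \<pi> \<and> lab b \<noteq> 0. lab b * hook_length \<pi> b)"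

end

theory Submission
  imports Defs
begin

text \<open>Give step \<open>k\<close> of the profile the label \<open>k\<close>. Replacing a peak \<open>\<rho>\<close> between \<open>\<alpha>\<close> and \<open>\<beta>\<close> by the
  valley \<open>\<mu>\<^sub>n = min \<alpha>\<^sub>n \<beta>\<^sub>n + max \<alpha>\<^sub>n\<^sub>+\<^sub>1 \<beta>\<^sub>n\<^sub>+\<^sub>1 - \<rho>\<^sub>n\<^sub>+\<^sub>1\<close> loses exactly the number
  \<open>m = \<rho>\<^sub>1 - max \<alpha>\<^sub>1 \<beta>\<^sub>1\<close>, and exchanges an upward step labelled \<open>i\<close> with the downward step labelled \<open>j\<close>
  after it; the weight drops by \<open>m (j - i)\<close>. Moving the last step to the front preserves the weight
  if its label is lowered by \<open>T\<close>. Repeatedly moving all upward steps past all downward steps and then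
  around the cylinder, the upward step \<open>i\<close> meets the downward step \<open>j\<close> once with each label
  \<open>i - k T\<close>, that is, once for each box \<open>(i, j, k)\<close>. The process never ends, but in a fixed weight
  only constant sequences survive sufficiently many rounds, so the bijection is assembled weight by
  weight.\<close>

section \<open>Weight preserving bijections\<close>

text \<open>Only the existence of a bijection is recorded, so that equivalences can be chained
  without naming the composites. Weights are integers because moving steps around the cylinder makes
  their labels negative.\<close>

definition weight_equiv :: "'a set \<Rightarrow> ('a \<Rightarrow> int) \<Rightarrow> 'b set \<Rightarrow> ('b \<Rightarrow> int) \<Rightarrow> bool" where
  "weight_equiv A w B v \<longleftrightarrow> (\<exists>f. bij_betw f A B \<and> (\<forall>x\<in>A. v (f x) = w x))"

lemma weight_equivI:
  assumes "\<And>x. x \<in> A \<Longrightarrow> f x \<in> B" "\<And>y. y \<in> B \<Longrightarrow> g y \<in> A"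
    and "\<And>x. x \<in> A \<Longrightarrow> g (f x) = x" "\<And>y. y \<in> B \<Longrightarrow> f (g y) = y"
    and "\<And>x. x \<in> A \<Longrightarrow> v (f x) = w x"
  shows "weight_equiv A w B v"
  unfolding weight_equiv_def
  by (intro exI[of _ f] conjI ballI bij_betw_byWitness[where f' = g]) (use assms in auto)

lemma weight_equiv_trans:
  assumes "weight_equiv A w B v" "weight_equiv B v C u"
  shows "weight_equiv A w C u"
proof -
  obtain f g where f: "bij_betw f A B" "\<forall>x\<in>A. v (f x) = w x"
    and g: "bij_betw g B C" "\<forall>y\<in>B. u (g y) = v y"
    using assms unfolding weight_equiv_def by blast
  have "\<forall>x\<in>A. u ((g \<circ> f) x) = w x"
    using f g bij_betwE[OF f(1)] by simp
  then show ?thesis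
    using bij_betw_trans[OF f(1) g(1)] unfolding weight_equiv_def by blast
qed

lemma weight_equiv_sym:
  assumes "weight_equiv A w B v"
  shows "weight_equiv B v A w"
proof -
  obtain f where f: "bij_betw f A B" "\<forall>x\<in>A. v (f x) = w x"
    using assms unfolding weight_equiv_def by blast
  have "w (inv_into A f y) = v y" if "y \<in> B" for y
  proof -
    have "inv_into A f y \<in> A" "f (inv_into A f y) = y"
      using f(1) that by (auto simp: bij_betw_def inv_into_into f_inv_into_f)
    then show ?thesis using f(2) by metis
  qed
  then show ?thesis
    using bij_betw_inv_into[OF f(1)] unfolding weight_equiv_def by blast
qed

lemma weight_equiv_Times:
  assumes "weight_equiv A w A' w'" "weight_equiv B v B' v'"
  shows "weight_equiv (A \<times> B) (\<lambda>(x, y). w x + v y) (A' \<times> B') (\<lambda>(x, y). w' x + v' y)"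
proof -
  obtain f g where f: "bij_betw f A A'" "\<forall>x\<in>A. w' (f x) = w x"
    and g: "bij_betw g B B'" "\<forall>y\<in>B. v' (g y) = v y"
    using assms unfolding weight_equiv_def by blast
  show ?thesis
    unfolding weight_equiv_def
    by (rule exI[of _ "map_prod f g"])
      (use bij_betw_map_prod[OF f(1) g(1)] f g in auto)
qed

lemma weight_equiv_refl: "weight_equiv A w A w"
  by (rule weight_equivI[of _ id _ id]) auto

lemma weight_equiv_empty: "weight_equiv {} w {} v"
  by (simp add: weight_equiv_def bij_betw_def)

lemma weight_equiv_fibre:
  assumes "weight_equiv A w B v"
  shows "weight_equiv {x \<in> A. w x = n} w {y \<in> B. v y = n} v"
proof -
  obtain f where f: "bij_betw f A B" "\<forall>x\<in>A. v (f x) = w x"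
    using assms unfolding weight_equiv_def by blast
  have "{y \<in> B. v y = n} = f ` {x \<in> A. w x = n}"
    using f by (auto simp: bij_betw_def)
  then have "bij_betw f {x \<in> A. w x = n} {y \<in> B. v y = n}"
    using f(1) by (auto simp: bij_betw_def inj_on_def)
  then show ?thesis
    using f(2) unfolding weight_equiv_def by blast
qed

text \<open>Elements of different weight never collide, so bijections chosen independently for each
  weight glue together. This permits a number of rounds that depends on the weight.\<close>

lemma weight_equiv_of_fibres:
  assumes "\<And>n. weight_equiv {x \<in> A. w x = n} w {y \<in> B. v y = n} v"
  shows "weight_equiv A w B v"
proof -
  obtain f where f: "\<And>n. bij_betw (f n) {x \<in> A. w x = n} {y \<in> B. v y = n}"
    using assms unfolding weight_equiv_def by metis
  define F where "F x = f (w x) x" for x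
  have fib: "F x \<in> B \<and> v (F x) = w x" if "x \<in> A" for x
    using bij_betwE[OF f[of "w x"]] that by (auto simp: F_def)
  have "inj_on F A"
  proof (rule inj_onI)
    fix x y assume xy: "x \<in> A" "y \<in> A" "F x = F y"
    then have "w x = w y" using fib by metis
    then show "x = y"
      using xy f[of "w x"] by (auto simp: F_def bij_betw_def inj_on_def)
  qed
  moreover have "F ` A = B"
  proof
    show "F ` A \<subseteq> B" using fib by auto
    show "B \<subseteq> F ` A"
    proof
      fix y assume "y \<in> B"
      then have "y \<in> f (v y) ` {x \<in> A. w x = v y}"
        using f[of "v y"] by (auto simp: bij_betw_def)
      then obtain x where "x \<in> A" "w x = v y" "y = f (v y) x" by blast
      then show "y \<in> F ` A" by (intro image_eqI[of _ _ x]) (auto simp: F_def)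
    qed
  qed
  ultimately show ?thesis
    using fib unfolding weight_equiv_def bij_betw_def by blast
qed


section \<open>Finitely supported labellings\<close>

text \<open>The index set is arbitrary: it will be a set of boxes as well as a set of pairs of step
  labels met during the process.\<close>

definition labellings :: "'a set \<Rightarrow> ('a \<Rightarrow> nat) set" where
  "labellings S = {d. finite {b. d b \<noteq> 0} \<and> (\<forall>b. b \<notin> S \<longrightarrow> d b = 0)}"

definition label_weight :: "('a \<Rightarrow> int) \<Rightarrow> ('a \<Rightarrow> nat) \<Rightarrow> int" where
  "label_weight h d = (\<Sum>b | d b \<noteq> 0. int (d b) * h b)"

lemma label_weight_superset:
  assumes "finite U" "{b. d b \<noteq> 0} \<subseteq> U"
  shows "label_weight h d = (\<Sum>b\<in>U. int (d b) * h b)"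
  unfolding label_weight_def by (rule sum.mono_neutral_left) (use assms in auto)

lemma label_weight_add:
  assumes "finite {b. d b \<noteq> 0}" "finite {b. e b \<noteq> 0}"
  shows "label_weight h (\<lambda>b. d b + e b) = label_weight h d + label_weight h e"
proof -
  define U where "U = {b. d b \<noteq> 0} \<union> {b. e b \<noteq> 0}"
  have "finite U" using assms by (simp add: U_def)
  then have "label_weight h d = (\<Sum>b\<in>U. int (d b) * h b)"
    "label_weight h e = (\<Sum>b\<in>U. int (e b) * h b)"
    by (auto intro!: label_weight_superset simp: U_def)
  moreover have "label_weight h (\<lambda>b. d b + e b) = (\<Sum>b\<in>U. int (d b + e b) * h b)"
    by (rule label_weight_superset) (use \<open>finite U\<close> in \<open>auto simp: U_def\<close>)
  ultimately show ?thesis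
    by (simp add: distrib_right sum.distrib)
qed

lemma labellings_finite_support: "d \<in> labellings S \<Longrightarrow> finite {b. d b \<noteq> 0}"
  by (simp add: labellings_def)

lemma labellings_restrict:
  assumes "d \<in> labellings S"
  shows "(\<lambda>b. if b \<in> S' then d b else 0) \<in> labellings S'"
proof -
  have "{b. (if b \<in> S' then d b else 0) \<noteq> 0} \<subseteq> {b. d b \<noteq> 0}"
    by auto
  moreover have "finite {b. d b \<noteq> 0}"
    using assms by (simp add: labellings_def)
  ultimately have "finite {b. (if b \<in> S' then d b else 0) \<noteq> 0}"
    by (rule finite_subset)
  then show ?thesis
    by (simp add: labellings_def)
qed

lemma labellings_add:
  assumes "d \<in> labellings S" "e \<in> labellings S'"
  shows "(\<lambda>b. d b + e b) \<in> labellings (S \<union> S')"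
proof -
  have "{b. d b + e b \<noteq> 0} = {b. d b \<noteq> 0} \<union> {b. e b \<noteq> 0}"
    by auto
  then show ?thesis
    using assms unfolding labellings_def by auto
qed

text \<open>Restriction to the two disjoint parts inverts pointwise addition. This merges the
  numbers split off in two successive stages of the process.\<close>

lemma weight_equiv_labellings_Un:
  assumes "S \<inter> S' = {}"
  shows "weight_equiv (labellings S \<times> labellings S') (\<lambda>(d, e). label_weight h d + label_weight h e)
    (labellings (S \<union> S')) (label_weight h)"
proof (rule weight_equivI[where f = "\<lambda>(d, e). \<lambda>b. d b + e b" and
      g = "\<lambda>d. (\<lambda>b. if b \<in> S then d b else 0, \<lambda>b. if b \<in> S' then d b else 0)"],
      goal_cases)
  case (1 x)
  then show ?case by (auto intro: labellings_add)
next
  case (2 y)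
  then show ?case by (auto intro: labellings_restrict)
next
  case (3 x)
  then have "fst x b = 0 \<or> b \<in> S \<and> b \<notin> S'" "snd x b = 0 \<or> b \<in> S' \<and> b \<notin> S" for b
    using assms by (auto simp: labellings_def)
  then show ?case using 3 by (fastforce simp: labellings_def fun_eq_iff split: prod.splits)
next
  case (4 y)
  then show ?case using assms by (auto simp: labellings_def fun_eq_iff)
next
  case (5 x)
  then show ?case
    by (auto intro!: label_weight_add dest: labellings_finite_support)
qed

text \<open>Labels are transported along an injection. It will rename boxes as pairs of step labels,
  with hook lengths turning into label differences.\<close>

lemma weight_equiv_labellings_image:
  assumes "inj_on \<phi> S" and "\<And>b. b \<in> S \<Longrightarrow> h' (\<phi> b) = h b"
  shows "weight_equiv (labellings S) (label_weight h) (labellings (\<phi> ` S)) (label_weight h')"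
proof -
  define f where "f d p = (if p \<in> \<phi> ` S then d (inv_into S \<phi> p) else 0)" for d :: "'a \<Rightarrow> nat" and p
  define g where "g e b = (if b \<in> S then e (\<phi> b) else 0)" for e :: "'b \<Rightarrow> nat" and b
  have f_image: "f d (\<phi> b) = d b" if "b \<in> S" for d b
    using that assms(1) by (simp add: f_def)
  have supp_f: "{p. f d p \<noteq> 0} = \<phi> ` {b. d b \<noteq> 0}" if "d \<in> labellings S" for d
  proof -
    have "b \<in> S" if "d b \<noteq> 0" for b
      using that \<open>d \<in> labellings S\<close> by (auto simp: labellings_def)
    moreover have "p \<in> \<phi> ` S" if "f d p \<noteq> 0" for p
      using that by (simp add: f_def split: if_splits)
    ultimately show ?thesis
      by (fastforce simp: f_image)
  qed
  show ?thesis
  proof (rule weight_equivI[where f = f and g = g])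
    fix d assume d: "d \<in> labellings S"
    show "f d \<in> labellings (\<phi> ` S)"
      using d supp_f[OF d] by (auto simp: labellings_def f_def)
    show "g (f d) = d"
      using d by (auto simp: g_def f_image labellings_def fun_eq_iff)
    have sub: "{b. d b \<noteq> 0} \<subseteq> S"
      using d by (auto simp: labellings_def)
    have "label_weight h' (f d) = (\<Sum>p\<in>\<phi> ` {b. d b \<noteq> 0}. int (f d p) * h' p)"
      unfolding label_weight_def supp_f[OF d] ..
    also have "\<dots> = (\<Sum>b | d b \<noteq> 0. int (f d (\<phi> b)) * h' (\<phi> b))"
      using inj_on_subset[OF assms(1) sub] by (simp add: sum.reindex)
    also have "\<dots> = label_weight h d"
      unfolding label_weight_def using sub f_image assms(2) by (intro sum.cong) auto
    finally show "label_weight h' (f d) = label_weight h d" .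
  next
    fix e assume e: "e \<in> labellings (\<phi> ` S)"
    have "\<phi> ` {b. g e b \<noteq> 0} \<subseteq> {p. e p \<noteq> 0}"
      by (auto simp: g_def)
    then have "finite (\<phi> ` {b. g e b \<noteq> 0})"
      using e finite_subset by (auto simp: labellings_def)
    moreover have "inj_on \<phi> {b. g e b \<noteq> 0}"
      by (rule inj_on_subset[OF assms(1)]) (auto simp: g_def)
    ultimately have "finite {b. g e b \<noteq> 0}"
      by (rule finite_imageD)
    then show "g e \<in> labellings S"
      by (auto simp: labellings_def g_def)
    show "f (g e) = e"
    proof
      fix p
      show "f (g e) p = e p"
      proof (cases "p \<in> \<phi> ` S")
        case True
        then obtain b where "b \<in> S" "p = \<phi> b" by blast
        then show ?thesis by (simp add: f_image) (simp add: g_def)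
      next
        case False
        then show ?thesis using e by (auto simp: f_def labellings_def)
      qed
    qed
  qed
qed

lemma label_le_label_weight:
  assumes "d \<in> labellings S" "\<And>b. b \<in> S \<Longrightarrow> 0 \<le> h b"
  shows "int (d b) * h b \<le> label_weight h d" "0 \<le> label_weight h d"
proof -
  have nonneg: "0 \<le> int (d b) * h b" for b
    using assms by (cases "b \<in> S") (auto simp: labellings_def)
  then show "0 \<le> label_weight h d"
    unfolding label_weight_def by (intro sum_nonneg) auto
  show "int (d b) * h b \<le> label_weight h d"
  proof (cases "d b = 0")
    case False
    then show ?thesis
      unfolding label_weight_def
      using labellings_finite_support[OF assms(1)] nonneg by (intro member_le_sum) auto
  qed (use \<open>0 \<le> label_weight h d\<close> in simp)
qed


section \<open>The local rule\<close>

lemma partition_weight_eq: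
  assumes "\<And>n. n \<ge> N \<Longrightarrow> \<nu> n = 0"
  shows "partition_weight \<nu> = (\<Sum>n<N. \<nu> n)"
  unfolding partition_weight_def
proof (rule sum.mono_neutral_left)
  show "{n. \<nu> n \<noteq> 0} \<subseteq> {..<N}"
    using assms by (metis (mono_tags) lessThan_iff mem_Collect_eq not_le subsetI)
qed auto

text \<open>Each sequence is squeezed between values of the other, which forces both to decrease;
  vanishing passes from one to the other with the bound growing by at most one. Thus partitions made
  by the local rule lie in \<open>IP\<close>.\<close>

lemma horizontal_strip_IP:
  assumes "horizontal_strip \<nu> \<mu>"
  shows "\<nu> \<in> IP \<longleftrightarrow> \<mu> \<in> IP"
proof -
  have le: "\<mu> n \<le> \<nu> n" "\<nu> (Suc n) \<le> \<mu> n" for n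
    using assms by (auto simp: horizontal_strip_def)
  have "antimono \<nu>" "antimono \<mu>"
    unfolding antimono_iff_le_Suc using le by (blast intro: order_trans)+
  moreover have "(\<exists>N. \<forall>n\<ge>N. \<nu> n = 0) \<longleftrightarrow> (\<exists>N. \<forall>n\<ge>N. \<mu> n = 0)"
  proof
    assume "\<exists>N. \<forall>n\<ge>N. \<nu> n = 0"
    then show "\<exists>N. \<forall>n\<ge>N. \<mu> n = 0"
      using le(1) by (metis le_zero_eq)
  next
    assume "\<exists>N. \<forall>n\<ge>N. \<mu> n = 0"
    then obtain N where "\<forall>n\<ge>N. \<mu> n = 0" ..
    then have "\<forall>n\<ge>Suc N. \<nu> n = 0"
      using le(2) by (metis Suc_le_D Suc_le_mono le_zero_eq)
    then show "\<exists>N. \<forall>n\<ge>N. \<nu> n = 0" ..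
  qed
  ultimately show ?thesis
    by (simp add: IP_def)
qed

lemma IP_common_bound:
  assumes "\<alpha> \<in> IP" "\<beta> \<in> IP"
  obtains N where "\<And>n. n \<ge> N \<Longrightarrow> \<alpha> n = 0" "\<And>n. n \<ge> N \<Longrightarrow> \<beta> n = 0"
proof -
  obtain N M where "\<forall>n\<ge>N. \<alpha> n = 0" "\<forall>n\<ge>M. \<beta> n = 0"
    using assms unfolding IP_def by blast
  then show thesis
    using that[of "max N M"] by simp
qed

text \<open>The strip gives an inequality for every part, so equal sums force equal parts.\<close>

lemma horizontal_strip_weight_le:
  assumes "horizontal_strip \<nu> \<mu>" "\<nu> \<in> IP" "\<mu> \<in> IP"
  shows "partition_weight \<mu> \<le> partition_weight \<nu>"
    and "partition_weight \<mu> = partition_weight \<nu> \<Longrightarrow> \<mu> = \<nu>"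
proof -
  obtain N where N: "\<And>n. n \<ge> N \<Longrightarrow> \<nu> n = 0" "\<And>n. n \<ge> N \<Longrightarrow> \<mu> n = 0"
    using IP_common_bound[OF assms(2,3)] by blast
  have le: "\<mu> n \<le> \<nu> n" for n
    using assms(1) by (auto simp: horizontal_strip_def)
  have weights: "partition_weight \<mu> = (\<Sum>n<N. \<mu> n)" "partition_weight \<nu> = (\<Sum>n<N. \<nu> n)"
    using N by (auto intro: partition_weight_eq)
  show "partition_weight \<mu> \<le> partition_weight \<nu>"
    unfolding weights by (intro sum_mono le)
  assume "partition_weight \<mu> = partition_weight \<nu>"
  then have "\<mu> n = \<nu> n" if "n < N" for n
    using sum_mono_inv[of \<mu> "{..<N}" \<nu> n] that le unfolding weights by simp
  then show "\<mu> = \<nu>"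
    using N by (metis ext not_less)
qed

text \<open>This is a piecewise linear toggle: \<open>\<rho> (Suc n)\<close> is reflected in the
  interval from \<open>max (\<alpha> (Suc n)) (\<beta> (Suc n))\<close> to
  \<open>min (\<alpha> n) (\<beta> n)\<close>. For a peak \<open>\<rho>\<close> it lies in that
  interval, so the subtraction does not truncate.\<close>

definition local_down :: "(nat \<Rightarrow> nat) \<Rightarrow> (nat \<Rightarrow> nat) \<Rightarrow> (nat \<Rightarrow> nat) \<Rightarrow> nat \<Rightarrow> nat" where
  "local_down \<alpha> \<beta> \<rho> n = min (\<alpha> n) (\<beta> n) + max (\<alpha> (Suc n)) (\<beta> (Suc n)) - \<rho> (Suc n)"

definition local_up :: "(nat \<Rightarrow> nat) \<Rightarrow> (nat \<Rightarrow> nat) \<Rightarrow> nat \<Rightarrow> (nat \<Rightarrow> nat) \<Rightarrow> nat \<Rightarrow> nat" where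
  "local_up \<alpha> \<beta> m \<mu> n = (case n of 0 \<Rightarrow> max (\<alpha> 0) (\<beta> 0) + m
     | Suc k \<Rightarrow> min (\<alpha> k) (\<beta> k) + max (\<alpha> (Suc k)) (\<beta> (Suc k)) - \<mu> k)"

definition local_label :: "(nat \<Rightarrow> nat) \<Rightarrow> (nat \<Rightarrow> nat) \<Rightarrow> (nat \<Rightarrow> nat) \<Rightarrow> nat" where
  "local_label \<alpha> \<beta> \<rho> = \<rho> 0 - max (\<alpha> 0) (\<beta> 0)"

text \<open>Reflection keeps an entry in its interval and is an involution, so all parts but the
  first can be recovered. The first part \<open>\<rho> 0\<close> is bounded only from below, and
  \<open>local_label\<close> stores its excess over this bound.\<close>

lemma local_down:
  assumes "horizontal_strip \<rho> \<alpha>" "horizontal_strip \<rho> \<beta>"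
  shows "horizontal_strip \<alpha> (local_down \<alpha> \<beta> \<rho>)" "horizontal_strip \<beta> (local_down \<alpha> \<beta> \<rho>)"
    and "local_up \<alpha> \<beta> (local_label \<alpha> \<beta> \<rho>) (local_down \<alpha> \<beta> \<rho>) = \<rho>"
proof -
  have ineqs: "\<alpha> n \<le> \<rho> n" "\<beta> n \<le> \<rho> n" "\<rho> (Suc n) \<le> \<alpha> n" "\<rho> (Suc n) \<le> \<beta> n" for n
    using assms by (auto simp: horizontal_strip_def)
  have bounds: "local_down \<alpha> \<beta> \<rho> n \<le> min (\<alpha> n) (\<beta> n)"
    "max (\<alpha> (Suc n)) (\<beta> (Suc n)) \<le> local_down \<alpha> \<beta> \<rho> n" for n
    using ineqs[of n] ineqs[of "Suc n"] unfolding local_down_def by linarith+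
  show "horizontal_strip \<alpha> (local_down \<alpha> \<beta> \<rho>)" "horizontal_strip \<beta> (local_down \<alpha> \<beta> \<rho>)"
    using bounds unfolding horizontal_strip_def by simp_all
  show "local_up \<alpha> \<beta> (local_label \<alpha> \<beta> \<rho>) (local_down \<alpha> \<beta> \<rho>) = \<rho>"
  proof
    fix n
    show "local_up \<alpha> \<beta> (local_label \<alpha> \<beta> \<rho>) (local_down \<alpha> \<beta> \<rho>) n = \<rho> n"
    proof (cases n)
      case 0
      then show ?thesis
        using ineqs[of 0] by (simp add: local_up_def local_label_def)
    next
      case (Suc k)
      then show ?thesis
        using ineqs[of k] by (simp add: local_up_def local_down_def)
    qed
  qed
qed

text \<open>The interval conditions on a valley are those on a peak without its first part. That
  part may exceed \<open>max (\<alpha> 0) (\<beta> 0)\<close> by any amount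
  \<open>m\<close>.\<close>

lemma local_up:
  assumes "horizontal_strip \<alpha> \<mu>" "horizontal_strip \<beta> \<mu>"
  shows "horizontal_strip (local_up \<alpha> \<beta> m \<mu>) \<alpha>" "horizontal_strip (local_up \<alpha> \<beta> m \<mu>) \<beta>"
    and "local_down \<alpha> \<beta> (local_up \<alpha> \<beta> m \<mu>) = \<mu>"
    and "local_label \<alpha> \<beta> (local_up \<alpha> \<beta> m \<mu>) = m"
proof -
  have ineqs: "\<mu> n \<le> \<alpha> n" "\<mu> n \<le> \<beta> n" "\<alpha> (Suc n) \<le> \<mu> n" "\<beta> (Suc n) \<le> \<mu> n" for n
    using assms by (auto simp: horizontal_strip_def)
  have "max (\<alpha> n) (\<beta> n) \<le> local_up \<alpha> \<beta> m \<mu> n" for n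
  proof (cases n)
    case (Suc k)
    have "max (\<alpha> n) (\<beta> n) \<le> min (\<alpha> k) (\<beta> k) + max (\<alpha> n) (\<beta> n) - \<mu> k"
      using ineqs[of k] by linarith
    then show ?thesis
      using Suc by (simp add: local_up_def)
  qed (simp add: local_up_def)
  moreover have "local_up \<alpha> \<beta> m \<mu> (Suc n) \<le> min (\<alpha> n) (\<beta> n)" for n
  proof -
    have "min (\<alpha> n) (\<beta> n) + max (\<alpha> (Suc n)) (\<beta> (Suc n)) - \<mu> n \<le> min (\<alpha> n) (\<beta> n)"
      using ineqs[of n] by linarith
    then show ?thesis
      by (simp add: local_up_def)
  qed
  ultimately show "horizontal_strip (local_up \<alpha> \<beta> m \<mu>) \<alpha>" "horizontal_strip (local_up \<alpha> \<beta> m \<mu>) \<beta>"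
    unfolding horizontal_strip_def by simp_all
  show "local_down \<alpha> \<beta> (local_up \<alpha> \<beta> m \<mu>) = \<mu>"
  proof
    fix n
    show "local_down \<alpha> \<beta> (local_up \<alpha> \<beta> m \<mu>) n = \<mu> n"
      using ineqs[of n] by (simp add: local_up_def local_down_def)
  qed
  show "local_label \<alpha> \<beta> (local_up \<alpha> \<beta> m \<mu>) = m"
    by (simp add: local_up_def local_label_def)
qed

text \<open>A reflected entry and its image add up to the sum of the interval ends. Summing over
  \<open>n\<close>, minima and maxima recombine to the parts of \<open>\<alpha>\<close> and
  \<open>\<beta>\<close>; the maximum at index 0 comes from \<open>\<rho> 0\<close>, up to the
  label.\<close>

lemma local_weight:
  assumes "horizontal_strip \<rho> \<alpha>" "horizontal_strip \<rho> \<beta>" "\<alpha> \<in> IP" "\<beta> \<in> IP"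
  shows "partition_weight \<rho> + partition_weight (local_down \<alpha> \<beta> \<rho>)
    = partition_weight \<alpha> + partition_weight \<beta> + local_label \<alpha> \<beta> \<rho>"
proof -
  obtain N where N: "\<And>n. n \<ge> N \<Longrightarrow> \<alpha> n = 0" "\<And>n. n \<ge> N \<Longrightarrow> \<beta> n = 0"
    using IP_common_bound[OF assms(3,4)] by blast
  have ineqs: "\<alpha> n \<le> \<rho> n" "\<beta> n \<le> \<rho> n" "\<rho> (Suc n) \<le> \<alpha> n" "\<rho> (Suc n) \<le> \<beta> n" for n
    using assms by (auto simp: horizontal_strip_def)
  let ?\<mu> = "local_down \<alpha> \<beta> \<rho>"
  let ?M = "\<lambda>n. max (\<alpha> n) (\<beta> n)"
  let ?m = "\<lambda>n. min (\<alpha> n) (\<beta> n)"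
  have "?\<mu> n = 0" if "n \<ge> N" for n
    using local_down(1)[OF assms(1,2)] N(1)[OF that] unfolding horizontal_strip_def
    by (metis le_zero_eq)
  then have \<mu>: "partition_weight ?\<mu> = (\<Sum>n<N. ?\<mu> n)"
    by (rule partition_weight_eq)
  have "\<rho> n = 0" if "n \<ge> Suc N" for n
    using that ineqs(3)[of "n - 1"] N(1)[of "n - 1"] by simp
  then have "partition_weight \<rho> = (\<Sum>n<Suc N. \<rho> n)"
    by (rule partition_weight_eq)
  then have "partition_weight \<rho> + partition_weight ?\<mu> = \<rho> 0 + (\<Sum>n<N. \<rho> (Suc n) + ?\<mu> n)"
    unfolding \<mu> by (simp add: sum.lessThan_Suc_shift sum.distrib del: sum.lessThan_Suc)
  also have "\<dots> = \<rho> 0 + (\<Sum>n<N. ?m n + ?M (Suc n))"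
  proof -
    have "\<rho> (Suc n) + ?\<mu> n = ?m n + ?M (Suc n)" for n
      using ineqs[of n] by (simp add: local_down_def)
    then show ?thesis by simp
  qed
  also have "\<dots> = local_label \<alpha> \<beta> \<rho> + (\<Sum>n<N. ?m n) + (?M 0 + (\<Sum>n<N. ?M (Suc n)))"
    using ineqs[of 0] by (simp add: local_label_def sum.distrib)
  also have "?M 0 + (\<Sum>n<N. ?M (Suc n)) = (\<Sum>n<Suc N. ?M n)"
    by (simp add: sum.lessThan_Suc_shift del: sum.lessThan_Suc)
  \<comment> \<open>The extra term at index \<open>N\<close> vanishes, since \<open>\<alpha>\<close>
    and \<open>\<beta>\<close> are zero from \<open>N\<close> on.\<close>
  also have "\<dots> = (\<Sum>n<N. ?M n)"
    using N by simp
  also have "local_label \<alpha> \<beta> \<rho> + (\<Sum>n<N. ?m n) + (\<Sum>n<N. ?M n)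
      = local_label \<alpha> \<beta> \<rho> + (\<Sum>n<N. \<alpha> n + \<beta> n)"
  proof -
    have "?m n + ?M n = \<alpha> n + \<beta> n" for n
      by (simp add: max_def min_def)
    then show ?thesis
      by (simp flip: sum.distrib)
  qed
  also have "\<dots> = partition_weight \<alpha> + partition_weight \<beta> + local_label \<alpha> \<beta> \<rho>"
    using partition_weight_eq[OF N(1)] partition_weight_eq[OF N(2)] by (simp add: sum.distrib)
  finally show ?thesis .
qed


section \<open>Closed walks with labelled steps\<close>

definition interlace :: "bool \<Rightarrow> (nat \<Rightarrow> nat) \<Rightarrow> (nat \<Rightarrow> nat) \<Rightarrow> bool" where
  "interlace up \<mu> \<nu> \<longleftrightarrow> (if up then horizontal_strip \<nu> \<mu> else horizontal_strip \<mu> \<nu>)"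

text \<open>Only the directions of the steps matter here; the integer labels enter through the
  weight alone.\<close>

definition walks :: "(bool \<times> int) list \<Rightarrow> (nat \<Rightarrow> nat) list set" where
  "walks s = {c. length c = length s + 1 \<and> set c \<subseteq> IP \<and> c ! 0 = c ! length s \<and>
     (\<forall>k<length s. interlace (fst (s ! k)) (c ! k) (c ! Suc k))}"

text \<open>For \<open>T = length s\<close> and the labels \<open>1, \<dots>, T\<close> this is, by summation by parts, the weight of
  a cylindric plane partition. In this form the weight survives a change of the profile, as long as
  every step carries its label along.\<close>

definition walk_weight :: "int \<Rightarrow> (bool \<times> int) list \<Rightarrow> (nat \<Rightarrow> nat) list \<Rightarrow> int" where
  "walk_weight T s c = T * int (partition_weight (c ! 0)) - (\<Sum>k<length s. snd (s ! k) *
     (int (partition_weight (c ! Suc k)) - int (partition_weight (c ! k))))"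

text \<open>The bound on \<open>Suc q\<close> makes the changed vertex an interior one: the walk
  stays closed and only its two adjacent steps need checking.\<close>

lemma walks_update:
  assumes "c \<in> walks s" "length s' = length s" "Suc q < length s" "\<nu> \<in> IP"
    and "\<And>k. k < length s \<Longrightarrow> k \<noteq> q \<Longrightarrow> k \<noteq> Suc q \<Longrightarrow> s' ! k = s ! k"
    and "interlace (fst (s' ! q)) (c ! q) \<nu>" "interlace (fst (s' ! Suc q)) \<nu> (c ! Suc (Suc q))"
  shows "c[Suc q := \<nu>] \<in> walks s'"
proof -
  have "set (c[Suc q := \<nu>]) \<subseteq> IP"
    using assms(1,4) set_update_subset_insert[of c "Suc q" \<nu>] by (auto simp: walks_def)
  moreover have "interlace (fst (s' ! k)) (c[Suc q := \<nu>] ! k) (c[Suc q := \<nu>] ! Suc k)"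
    if "k < length s" for k
    using assms that by (cases "k = q"; cases "k = Suc q") (auto simp: walks_def nth_list_update)
  ultimately show ?thesis
    using assms(1-3) by (auto simp: walks_def nth_list_update)
qed

text \<open>Only the terms of the two adjacent steps change. As these exchange labels, the change
  factors into the difference of the labels and the quantity that \<open>local_weight\<close>
  identifies with the label of a peak.\<close>

lemma walk_weight_update:
  assumes "length c = length s + 1" "length s' = length s" "Suc q < length s"
    and "\<And>k. k < length s \<Longrightarrow> k \<noteq> q \<Longrightarrow> k \<noteq> Suc q \<Longrightarrow> s' ! k = s ! k"
    and "snd (s' ! q) = snd (s ! Suc q)" "snd (s' ! Suc q) = snd (s ! q)"
  shows "walk_weight T s c = walk_weight T s' (c[Suc q := \<nu>]) + (snd (s ! Suc q) - snd (s ! q)) *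
    (int (partition_weight (c ! Suc q)) + int (partition_weight \<nu>)
      - int (partition_weight (c ! q)) - int (partition_weight (c ! Suc (Suc q))))"
proof -
  let ?c' = "c[Suc q := \<nu>]"
  let ?F = "\<lambda>s c k. snd (s ! k) * (int (partition_weight (c ! Suc k)) - int (partition_weight (c ! k)))"
  define R where "R = {..<length s} - {q, Suc q}"
  have split: "(\<Sum>k<length s. f k) = f q + f (Suc q) + (\<Sum>k\<in>R. f k)" for f :: "nat \<Rightarrow> int"
  proof -
    have "{..<length s} = insert q (insert (Suc q) R)"
      using assms(3) by (auto simp: R_def)
    moreover have "finite R" "q \<notin> R" "Suc q \<notin> R"
      by (auto simp: R_def)
    ultimately show ?thesis
      by simp
  qed
  have "(\<Sum>k\<in>R. ?F s' ?c' k) = (\<Sum>k\<in>R. ?F s c k)"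
    using assms(4) by (intro sum.cong) (auto simp: R_def)
  moreover have "?c' ! 0 = c ! 0" "?c' ! Suc q = \<nu>" "?c' ! q = c ! q" "?c' ! Suc (Suc q) = c ! Suc (Suc q)"
    using assms(1,3) by auto
  ultimately show ?thesis
    using assms(2,5,6) unfolding walk_weight_def by (simp add: split algebra_simps)
qed

section \<open>Splitting labels off closed walks\<close>

text \<open>The cost of moving an up step with label \<open>i\<close> past a down step with label
  \<open>j\<close>; it will become the hook length of a box.\<close>

definition cross_weight :: "int \<times> int \<Rightarrow> int" where
  "cross_weight = (\<lambda>(i, j). j - i)"

text \<open>The set \<open>S\<close> collects the pairs of labels whose steps have passed each other
  on the way from \<open>s\<close> to \<open>s'\<close>, each storing one number.\<close>

definition reduces :: "int \<Rightarrow> (bool \<times> int) list \<Rightarrow> (int \<times> int) set \<Rightarrow> (bool \<times> int) list \<Rightarrow> bool" where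
  "reduces T s S s' \<longleftrightarrow> weight_equiv (walks s) (walk_weight T s) (labellings S \<times> walks s')
     (\<lambda>(d, c). label_weight cross_weight d + walk_weight T s' c)"

lemma reduces_empty:
  assumes "weight_equiv (walks s) (walk_weight T s) (walks s') (walk_weight T s')"
  shows "reduces T s {} s'"
  unfolding reduces_def
proof (rule weight_equiv_trans[OF assms], rule weight_equivI[where f = "\<lambda>c. (\<lambda>_. 0, c)" and g = snd])
qed (auto simp: labellings_def label_weight_def)

text \<open>Disjointness says that no pair of labels meets twice; only then do the two families of
  numbers form one labelling of the union.\<close>

lemma reduces_trans:
  assumes "reduces T s S s'" "reduces T s' S' s''" "S \<inter> S' = {}"
  shows "reduces T s (S \<union> S') s''"
proof -
  let ?L = "label_weight cross_weight"
  have "weight_equiv (walks s) (walk_weight T s) (labellings S \<times> (labellings S' \<times> walks s''))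
     (\<lambda>(d, x). ?L d + (case x of (e, c) \<Rightarrow> ?L e + walk_weight T s'' c))"
    by (rule weight_equiv_trans[OF assms(1)[unfolded reduces_def]
          weight_equiv_Times[OF weight_equiv_refl assms(2)[unfolded reduces_def]]])
  also have "weight_equiv (labellings S \<times> (labellings S' \<times> walks s''))
      (\<lambda>(d, x). ?L d + (case x of (e, c) \<Rightarrow> ?L e + walk_weight T s'' c))
      ((labellings S \<times> labellings S') \<times> walks s'')
      (\<lambda>(x, c). (case x of (d, e) \<Rightarrow> ?L d + ?L e) + walk_weight T s'' c)"
    by (rule weight_equivI[where f = "\<lambda>(d, e, c). ((d, e), c)" and g = "\<lambda>((d, e), c). (d, e, c)"]) auto
  also (weight_equiv_trans) have "weight_equiv ((labellings S \<times> labellings S') \<times> walks s'')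
      (\<lambda>(x, c). (case x of (d, e) \<Rightarrow> ?L d + ?L e) + walk_weight T s'' c)
      (labellings (S \<union> S') \<times> walks s'') (\<lambda>(d, c). ?L d + walk_weight T s'' c)"
    by (rule weight_equiv_Times[OF weight_equiv_labellings_Un[OF assms(3)] weight_equiv_refl])
  finally (weight_equiv_trans) show ?thesis
    unfolding reduces_def .
qed

lemma reduces_refl: "reduces T s {} s"
  by (intro reduces_empty weight_equiv_refl)

text \<open>The vertex between the two steps is a peak before and a valley after the exchange. The
  local rule trades one for the other, and its label \<open>m\<close> becomes the value at
  \<open>(i, j)\<close>.\<close>

lemma reduces_swap:
  "reduces T (xs @ (True, i) # (False, j) # ys) {(i, j)} (xs @ (False, j) # (True, i) # ys)"
proof -
  define s where "s = xs @ (True, i) # (False, j) # ys"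
  define s' where "s' = xs @ (False, j) # (True, i) # ys"
  define q where "q = length xs"
  have s: "length s' = length s" "Suc q < length s"
    "s ! q = (True, i)" "s ! Suc q = (False, j)" "s' ! q = (False, j)" "s' ! Suc q = (True, i)"
    "\<And>k. k \<noteq> q \<Longrightarrow> k \<noteq> Suc q \<Longrightarrow> s' ! k = s ! k"
    unfolding s_def s'_def q_def by (auto simp: nth_append nth_Cons split: nat.split)
  define down where "down c = c[Suc q := local_down (c ! q) (c ! Suc (Suc q)) (c ! Suc q)]"
    for c :: "(nat \<Rightarrow> nat) list"
  define m where "m c = local_label (c ! q) (c ! Suc (Suc q)) (c ! Suc q)"
    for c :: "(nat \<Rightarrow> nat) list"
  define up where "up m c = c[Suc q := local_up (c ! q) (c ! Suc (Suc q)) m (c ! Suc q)]"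
    for m and c :: "(nat \<Rightarrow> nat) list"
  have walk: "horizontal_strip (c ! Suc q) (c ! q)" "horizontal_strip (c ! Suc q) (c ! Suc (Suc q))"
    "c ! q \<in> IP" "c ! Suc q \<in> IP" "c ! Suc (Suc q) \<in> IP" "length c = length s + 1"
    if "c \<in> walks s" for c
    using that s spec[of "\<lambda>k. k < length s \<longrightarrow> interlace (fst (s ! k)) (c ! k) (c ! Suc k)" q]
      spec[of "\<lambda>k. k < length s \<longrightarrow> interlace (fst (s ! k)) (c ! k) (c ! Suc k)" "Suc q"]
    by (auto simp: walks_def interlace_def subset_iff)
  have walk': "horizontal_strip (c ! q) (c ! Suc q)" "horizontal_strip (c ! Suc (Suc q)) (c ! Suc q)"
    "c ! q \<in> IP" "c ! Suc q \<in> IP" "c ! Suc (Suc q) \<in> IP" "length c = length s + 1"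
    if "c \<in> walks s'" for c
    using that s spec[of "\<lambda>k. k < length s' \<longrightarrow> interlace (fst (s' ! k)) (c ! k) (c ! Suc k)" q]
      spec[of "\<lambda>k. k < length s' \<longrightarrow> interlace (fst (s' ! k)) (c ! k) (c ! Suc k)" "Suc q"]
    by (auto simp: walks_def interlace_def subset_iff)
  let ?L = "label_weight cross_weight"
  have "weight_equiv (walks s) (walk_weight T s) (labellings {(i, j)} \<times> walks s')
     (\<lambda>(d, c). ?L d + walk_weight T s' c)"
  proof (rule weight_equivI[where f = "\<lambda>c. (\<lambda>b. if b = (i, j) then m c else 0, down c)"
        and g = "\<lambda>(d, c). up (d (i, j)) c"])
    fix c assume c: "c \<in> walks s"
    have "down c \<in> walks s'"
      unfolding down_def
    proof (rule walks_update[OF c])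
      show "local_down (c ! q) (c ! Suc (Suc q)) (c ! Suc q) \<in> IP"
        using local_down(1)[OF walk(1,2)[OF c]] walk(3)[OF c] horizontal_strip_IP by blast
    qed (use s local_down(1,2)[OF walk(1,2)[OF c]] in \<open>auto simp: interlace_def\<close>)
    then show "((\<lambda>b. if b = (i, j) then m c else 0), down c) \<in> labellings {(i, j)} \<times> walks s'"
      by (auto simp: labellings_def)
    show "(case (\<lambda>b. if b = (i, j) then m c else 0, down c) of (d, c) \<Rightarrow> up (d (i, j)) c) = c"
      using local_down(3)[OF walk(1,2)[OF c]] walk(6)[OF c] s(2)
      by (simp add: up_def down_def m_def)
    have "?L (\<lambda>b. if b = (i, j) then m c else 0) = (\<Sum>b\<in>{(i, j)}. int (m c) * (j - i))"
      by (subst label_weight_superset[of "{(i, j)}"]) (auto simp: cross_weight_def)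
    moreover have "walk_weight T s c = walk_weight T s' (down c) + (j - i) * int (m c)"
      using local_weight[OF walk(1,2,3,5)[OF c]] s
      by (subst walk_weight_update[OF walk(6)[OF c] s(1,2), where
            \<nu> = "local_down (c ! q) (c ! Suc (Suc q)) (c ! Suc q)"])
        (auto simp: down_def m_def simp flip: of_nat_add)
    ultimately show "(case (\<lambda>b. if b = (i, j) then m c else 0, down c) of
        (d, c) \<Rightarrow> ?L d + walk_weight T s' c) = walk_weight T s c"
      by (simp add: mult.commute)
  next
    fix y assume "y \<in> labellings {(i, j)} \<times> walks s'"
    then obtain d c where y: "y = (d, c)" and d: "d \<in> labellings {(i, j)}" and c: "c \<in> walks s'"
      by blast
    have "up (d (i, j)) c \<in> walks s"
      unfolding up_def
    proof (rule walks_update[OF c])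
      show "local_up (c ! q) (c ! Suc (Suc q)) (d (i, j)) (c ! Suc q) \<in> IP"
        using local_up(1)[OF walk'(1,2)[OF c]] walk'(3)[OF c] horizontal_strip_IP by blast
    qed (use s local_up(1,2)[OF walk'(1,2)[OF c]] in \<open>auto simp: interlace_def\<close>)
    then show "(case y of (d, c) \<Rightarrow> up (d (i, j)) c) \<in> walks s"
      using y by simp
    have "m (up (d (i, j)) c) = d (i, j)" "down (up (d (i, j)) c) = c"
      using local_up(3,4)[OF walk'(1,2)[OF c]] walk'(6)[OF c] s(2)
      by (simp_all add: up_def down_def m_def)
    moreover have "d b = 0" if "b \<noteq> (i, j)" for b
      using d that by (cases b) (auto simp: labellings_def)
    ultimately show "(\<lambda>b. if b = (i, j) then m (case y of (d, c) \<Rightarrow> up (d (i, j)) c) else 0,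
        down (case y of (d, c) \<Rightarrow> up (d (i, j)) c)) = y"
      using y by auto
  qed
  then show ?thesis
    unfolding reduces_def s_def s'_def .
qed

text \<open>One exchange per down step; distinct labels keep the recorded pairs distinct.\<close>

lemma reduces_move:
  assumes "\<forall>z\<in>set zs. \<not> fst z" "distinct (map snd zs)"
  shows "reduces T (xs @ (True, i) # zs @ ys) ({i} \<times> snd ` set zs) (xs @ zs @ (True, i) # ys)"
  using assms
proof (induction zs arbitrary: xs)
  case Nil
  then show ?case by (simp add: reduces_refl)
next
  case (Cons z zs)
  obtain j where z: "z = (False, j)"
    using Cons.prems by (cases z) auto
  have "reduces T ((xs @ [z]) @ (True, i) # zs @ ys) ({i} \<times> snd ` set zs)
      ((xs @ [z]) @ zs @ (True, i) # ys)"
    by (rule Cons.IH) (use Cons.prems in auto)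
  then have "reduces T (xs @ (True, i) # (False, j) # zs @ ys) ({(i, j)} \<union> {i} \<times> snd ` set zs)
      (xs @ z # zs @ (True, i) # ys)"
    by (intro reduces_trans[OF reduces_swap]) (use Cons.prems z in auto)
  moreover have "{(i, j)} \<union> {i} \<times> snd ` set zs = {i} \<times> snd ` set (z # zs)"
    using z by auto
  ultimately show ?case
    using z by simp
qed

section \<open>Sorting all up steps behind the down steps\<close>

definition downs :: "(bool \<times> int) list \<Rightarrow> (bool \<times> int) list" where
  "downs s = filter (\<lambda>z. \<not> fst z) s"

definition ups :: "(bool \<times> int) list \<Rightarrow> (bool \<times> int) list" where
  "ups s = filter fst s"

text \<open>Positions are compared through labels: in a list with strictly increasing labels,
  \<open>i < j\<close> says that the up step comes first.\<close>

definition inversions :: "(bool \<times> int) list \<Rightarrow> (int \<times> int) set" where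
  "inversions s = {(i, j). (True, i) \<in> set s \<and> (False, j) \<in> set s \<and> i < j}"

text \<open>The tail is sorted first. A leading down step is then in place, and a leading up step
  moves past all the down steps.\<close>

lemma reduces_sort:
  assumes "sorted_wrt (\<lambda>y z. snd y < snd z) s"
  shows "reduces T (xs @ s @ ys) (inversions s) (xs @ downs s @ ups s @ ys)"
  using assms
proof (induction s arbitrary: xs)
  case Nil
  then show ?case by (simp add: inversions_def downs_def ups_def reduces_refl)
next
  case (Cons z s)
  obtain b x where z: "z = (b, x)" by (cases z)
  have x: "\<forall>y\<in>set s. x < snd y" and sorted: "sorted_wrt (\<lambda>y z. snd y < snd z) s"
    using Cons.prems z by auto
  have IH: "reduces T (xs @ z # s @ ys) (inversions s) (xs @ z # downs s @ ups s @ ys)"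
    using Cons.IH[OF sorted, of "xs @ [z]"] by simp
  show ?case
  proof (cases b)
    case False
    then have "inversions (z # s) = inversions s"
      using x z by (fastforce simp: inversions_def)
    then show ?thesis
      using IH False z by (simp add: downs_def ups_def)
  next
    case True
    have "distinct (map snd (downs s))"
    proof -
      have "sorted_wrt (<) (map snd (downs s))"
        using sorted sorted_wrt_filter unfolding downs_def sorted_wrt_map by blast
      then show ?thesis
        using strict_sorted_iff by blast
    qed
    then have "reduces T (xs @ z # downs s @ ups s @ ys) ({x} \<times> snd ` set (downs s))
        (xs @ downs s @ z # ups s @ ys)"
      unfolding z using True reduces_move[of "downs s" T xs x "ups s @ ys"]
      by (simp add: downs_def)
    \<comment> \<open>The label \<open>x\<close> lies below all labels in \<open>s\<close>, so no
      pair starting with \<open>x\<close> has been recorded yet.\<close>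
    then have "reduces T (xs @ z # s @ ys) (inversions s \<union> {x} \<times> snd ` set (downs s))
        (xs @ downs s @ z # ups s @ ys)"
      by (rule reduces_trans[OF IH]) (use x in \<open>auto simp: inversions_def\<close>)
    moreover have "inversions s \<union> {x} \<times> snd ` set (downs s) = inversions (z # s)"
      using x z True by (force simp: inversions_def downs_def)
    ultimately show ?thesis
      using z True by (simp add: downs_def ups_def)
  qed
qed

section \<open>Moving steps around the cylinder\<close>

text \<open>The same closed walk is read from the vertex before its last step: the repeated end
  vertex is dropped and the new start is repeated instead. The start term of the weight then loses
  \<open>T\<close> times the weight change along that step, which lowering its label by
  \<open>T\<close> restores.\<close>

lemma reduces_rotate1:
  "reduces T (xs @ [(b, z)]) {} ((b, z - T) # xs)"
proof (rule reduces_empty, rule weight_equivI[where f = "\<lambda>c. c ! length xs # butlast c"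
      and g = "\<lambda>c. tl c @ [c ! 1]"])
  fix c assume c: "c \<in> walks (xs @ [(b, z)])"
  then have len: "length c = length xs + 2" and IP: "set c \<subseteq> IP" and
    closed: "c ! Suc (length xs) = c ! 0" and
    steps: "\<And>k. k \<le> length xs \<Longrightarrow> interlace (fst ((xs @ [(b, z)]) ! k)) (c ! k) (c ! Suc k)"
    by (auto simp: walks_def)
  define c' where "c' = c ! length xs # butlast c"
  have c'_Suc: "c' ! Suc k = c ! k" if "k \<le> length xs" for k
    using that len by (simp add: c'_def nth_butlast)
  have c'_0: "c' ! 0 = c ! length xs"
    by (simp add: c'_def)
  have "interlace (fst (((b, z - T) # xs) ! k)) (c' ! k) (c' ! Suc k)" if "k \<le> length xs" for k
  proof (cases k)
    case 0
    then show ?thesis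
      using steps[of "length xs"] c'_Suc[of 0] c'_0 closed by simp
  next
    case (Suc l)
    then show ?thesis
      using steps[of l] c'_Suc[of l] c'_Suc[of k] that by (simp add: nth_append)
  qed
  moreover have "set c' \<subseteq> IP"
    using IP len in_set_butlastD[of _ c] by (auto simp: c'_def)
  ultimately show "c ! length xs # butlast c \<in> walks ((b, z - T) # xs)"
    using len c'_Suc[of "length xs"] c'_0 unfolding walks_def c'_def[symmetric]
    by (auto simp: less_Suc_eq_le) (simp add: c'_def)
  have "tl c' @ [c' ! 1] = butlast c @ [c ! 0]"
    using c'_Suc[of 0] by (simp add: c'_def)
  also have "c ! 0 = last c"
    using closed len by (subst last_conv_nth) auto
  finally show "tl (c ! length xs # butlast c) @ [(c ! length xs # butlast c) ! 1] = c"
    using len unfolding c'_def by (metis append_butlast_last_id length_0_conv add_is_0 zero_neq_numeral)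
  have "(\<Sum>k<length xs. snd (((b, z - T) # xs) ! Suc k) *
        (int (partition_weight (c' ! Suc (Suc k))) - int (partition_weight (c' ! Suc k))))
    = (\<Sum>k<length xs. snd ((xs @ [(b, z)]) ! k) *
        (int (partition_weight (c ! Suc k)) - int (partition_weight (c ! k))))"
    by (intro sum.cong) (auto simp: c'_Suc nth_append)
  then have "walk_weight T ((b, z - T) # xs) c' = T * int (partition_weight (c' ! 0)) -
      ((z - T) * (int (partition_weight (c' ! Suc 0)) - int (partition_weight (c' ! 0))) +
      (\<Sum>k<length xs. snd ((xs @ [(b, z)]) ! k) *
        (int (partition_weight (c ! Suc k)) - int (partition_weight (c ! k)))))"
    by (simp add: walk_weight_def sum.lessThan_Suc_shift del: sum.lessThan_Suc)
  then show "walk_weight T ((b, z - T) # xs) (c ! length xs # butlast c)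
      = walk_weight T (xs @ [(b, z)]) c"
    using c'_Suc[of 0] c'_0 closed unfolding walk_weight_def[of T "xs @ _"] c'_def[symmetric]
    by (simp add: algebra_simps)
next
  fix c assume c: "c \<in> walks ((b, z - T) # xs)"
  then have len: "length c = length xs + 2" and IP: "set c \<subseteq> IP" and
    closed: "c ! Suc (length xs) = c ! 0" and
    steps: "\<And>k. k \<le> length xs \<Longrightarrow> interlace (fst (((b, z - T) # xs) ! k)) (c ! k) (c ! Suc k)"
    by (auto simp: walks_def less_Suc_eq_le)
  define c' where "c' = tl c @ [c ! 1]"
  have c'_nth: "c' ! k = c ! Suc k" if "k \<le> length xs" for k
    using that len by (simp add: c'_def nth_append nth_tl)
  have c'_last: "c' ! Suc (length xs) = c ! 1"
    using len by (simp add: c'_def nth_append)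
  have "interlace (fst ((xs @ [(b, z)]) ! k)) (c' ! k) (c' ! Suc k)" if "k \<le> length xs" for k
  proof (cases "k = length xs")
    case True
    then show ?thesis
      using steps[of 0] c'_nth[of k] c'_last closed by simp
  next
    case False
    then show ?thesis
      using steps[of "Suc k"] c'_nth[of k] c'_nth[of "Suc k"] that by (simp add: nth_append)
  qed
  moreover have "set c' \<subseteq> IP"
    using IP len by (cases c) (auto simp: c'_def)
  moreover have "length c' = length xs + 2"
    using len by (simp add: c'_def)
  ultimately show "tl c @ [c ! 1] \<in> walks (xs @ [(b, z)])"
    using c'_nth[of 0] c'_last unfolding walks_def c'_def[symmetric]
    by (auto simp: less_Suc_eq_le)
  show "(tl c @ [c ! 1]) ! length xs # butlast (tl c @ [c ! 1]) = c"
    using c'_nth[of "length xs"] closed len unfolding c'_def[symmetric]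
    by (cases c) (auto simp: c'_def)
qed

definition shift_labels :: "int \<Rightarrow> (bool \<times> int) list \<Rightarrow> (bool \<times> int) list" where
  "shift_labels t s = map (apsnd (\<lambda>z. z - t)) s"

text \<open>The steps of \<open>ys\<close> are moved from the last to the first, so the block keeps
  its order.\<close>

lemma reduces_rotate: "reduces T (xs @ ys) {} (shift_labels T ys @ xs)"
proof (induction ys arbitrary: xs rule: rev_induct)
  case Nil
  then show ?case by (simp add: shift_labels_def reduces_refl)
next
  case (snoc y ys)
  obtain b z where y: "y = (b, z)" by (cases y)
  have "reduces T ((xs @ ys) @ [y]) ({} \<union> {}) (shift_labels T ys @ (b, z - T) # xs)"
    unfolding y by (rule reduces_trans[OF reduces_rotate1]) (use snoc[of "(b, z - T) # xs"] in auto)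
  then show ?case
    by (simp add: shift_labels_def y)
qed

lemma shift_labels_add: "shift_labels t (shift_labels u s) = shift_labels (t + u) s"
  by (auto simp: shift_labels_def apsnd_def)

lemma shift_labels_0: "shift_labels 0 s = s"
  by (induction s) (auto simp: shift_labels_def)

section \<open>Repeated rounds of rotating and sorting\<close>

lemma fst_downs: "z \<in> set (downs s) \<Longrightarrow> \<not> fst z"
  by (simp add: downs_def)

lemma fst_shift_ups: "z \<in> set (shift_labels t (ups s)) \<Longrightarrow> fst z"
  by (auto simp: shift_labels_def ups_def)

text \<open>Shifted labels of up steps are at most 0 and those of down steps positive, so after a
  rotation the labels increase again and the next sorting can start.\<close>

lemma sorted_shift_ups_downs:
  assumes "sorted_wrt (\<lambda>y z. snd y < snd z) s" "\<forall>z\<in>set s. 1 \<le> snd z \<and> snd z \<le> t"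
  shows "sorted_wrt (\<lambda>y z. snd y < snd z) (shift_labels t (ups s) @ downs s)"
proof -
  have "sorted_wrt (\<lambda>y z. snd y < snd z) (ups s)" "sorted_wrt (\<lambda>y z. snd y < snd z) (downs s)"
    using assms(1) by (auto simp: ups_def downs_def intro: sorted_wrt_filter)
  moreover have "snd y - t \<le> 0" "0 < snd y" if "y \<in> set s" for y
    using assms(2) that by auto
  ultimately show ?thesis
    by (force simp: sorted_wrt_append shift_labels_def sorted_wrt_map ups_def downs_def)
qed

text \<open>In round \<open>l\<close> the up step \<open>i\<close> carries the label
  \<open>i - int l * T\<close>. When all original labels lie between 1 and \<open>T\<close>, the
  inequality is a restriction only for \<open>l = 0\<close>.\<close>

definition crossings :: "int \<Rightarrow> (bool \<times> int) list \<Rightarrow> nat \<Rightarrow> (int \<times> int) set" where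
  "crossings T s k = {(i - int l * T, j) | i j l.
     l \<le> k \<and> (True, i) \<in> set s \<and> (False, j) \<in> set s \<and> i - int l * T < j}"

text \<open>Round 0 sorts \<open>s\<close>. Every further round rotates the block of up steps to the
  front, lowering its labels by \<open>T\<close>, and sorts again.\<close>

lemma reduces_rounds:
  assumes sorted: "sorted_wrt (\<lambda>y z. snd y < snd z) s"
    and labels: "\<forall>z\<in>set s. 1 \<le> snd z \<and> snd z \<le> T"
  shows "reduces T s (crossings T s k) (downs s @ shift_labels (int k * T) (ups s))"
proof (cases "s = []")
  case True
  then show ?thesis
    by (simp add: crossings_def downs_def ups_def shift_labels_def reduces_refl)
next
  case False
  then have T: "1 \<le> T"
    using labels by (cases s) force+
  show ?thesis
  proof (induction k)
    case 0
    have "crossings T s 0 = inversions s"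
      by (auto simp: crossings_def inversions_def)
    then show ?case
      using reduces_sort[OF sorted, of T "[]" "[]"]
      by (simp add: shift_labels_0)
  next
    case (Suc k)
    let ?t = "int (Suc k) * T"
    let ?r = "shift_labels ?t (ups s) @ downs s"
    have "T \<le> ?t"
      using T by (simp add: algebra_simps)
    then have sorted_r: "sorted_wrt (\<lambda>y z. snd y < snd z) ?r"
      using labels by (intro sorted_shift_ups_downs[OF sorted]) (blast intro: order_trans)
    have split_r: "downs ?r = downs s" "ups ?r = shift_labels ?t (ups s)"
      using fst_downs fst_shift_ups unfolding downs_def[of ?r] ups_def[of ?r]
      by (auto simp: filter_empty_conv filter_id_conv)
    have inv_r: "inversions ?r = {(i - ?t, j) | i j. (True, i) \<in> set s \<and> (False, j) \<in> set s \<and> i - ?t < j}"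
      by (force simp: inversions_def shift_labels_def ups_def downs_def)
    have "reduces T (downs s @ shift_labels (int k * T) (ups s)) {} ?r"
      using reduces_rotate[of T "downs s" "shift_labels (int k * T) (ups s)"]
      by (simp add: shift_labels_add algebra_simps)
    then have "reduces T s (crossings T s k \<union> {}) ?r"
      by (intro reduces_trans[OF Suc.IH]) auto
    moreover have "reduces T ?r (inversions ?r) (downs s @ shift_labels ?t (ups s))"
      using reduces_sort[OF sorted_r, of T "[]" "[]"] split_r by simp
    \<comment> \<open>In round \<open>l\<close> the labels of up steps lie between
      \<open>1 - int l * T\<close> and \<open>T - int l * T\<close>. These windows are disjoint for
      different rounds, so every pair recorded now is new.\<close>
    moreover have "crossings T s k \<inter> inversions ?r = {}"
    proof -
      have "i - ?t < i' - int l * T" if "l \<le> k" "(True, i) \<in> set s" "(True, i') \<in> set s" for l i i'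
      proof -
        have "int l * T \<le> int k * T"
          using that(1) T by (intro mult_right_mono) auto
        moreover have "i \<le> T" "1 \<le> i'"
          using labels that by force+
        ultimately show ?thesis
          by (simp add: algebra_simps)
      qed
      then show ?thesis
        unfolding inv_r crossings_def by fastforce
    qed
    ultimately have "reduces T s (crossings T s k \<union> inversions ?r) (downs s @ shift_labels ?t (ups s))"
      by (metis reduces_trans sup_bot_right)
    moreover have "crossings T s k \<union> inversions ?r = crossings T s (Suc k)"
      unfolding inv_r crossings_def le_Suc_eq by blast
    ultimately show ?case
      by simp
  qed
qed

section \<open>Constant walks and walks of small weight\<close>

text \<open>All differences in the weight vanish and only the start term remains. It is the source
  of the summand \<open>T * partition_weight \<gamma>\<close> in the theorem.\<close>

lemma walks_replicate:
  assumes "\<nu> \<in> IP"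
  shows "replicate (length s + 1) \<nu> \<in> walks s"
    and "walk_weight T s (replicate (length s + 1) \<nu>) = T * int (partition_weight \<nu>)"
proof -
  have "horizontal_strip \<nu> \<nu>"
    using assms by (auto simp: IP_def horizontal_strip_def antimono_iff_le_Suc)
  then show "replicate (length s + 1) \<nu> \<in> walks s"
    using assms by (auto simp: walks_def interlace_def nth_Cons' simp del: replicate.simps)
  have "(replicate (length s + 1) \<nu>) ! k = \<nu>" if "k \<le> length s" for k
    using that by (intro nth_replicate) simp
  then show "walk_weight T s (replicate (length s + 1) \<nu>) = T * int (partition_weight \<nu>)"
    by (simp add: walk_weight_def del: replicate.simps)
qed

lemma interlace_weight:
  assumes "c \<in> walks s" "k < length s"
  shows "fst (s ! k) \<Longrightarrow> partition_weight (c ! k) \<le> partition_weight (c ! Suc k)"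
    and "\<not> fst (s ! k) \<Longrightarrow> partition_weight (c ! Suc k) \<le> partition_weight (c ! k)"
    and "partition_weight (c ! Suc k) = partition_weight (c ! k) \<Longrightarrow> c ! Suc k = c ! k"
proof -
  have "interlace (fst (s ! k)) (c ! k) (c ! Suc k)" "c ! k \<in> IP" "c ! Suc k \<in> IP"
    using assms by (auto simp: walks_def subset_iff)
  then show "fst (s ! k) \<Longrightarrow> partition_weight (c ! k) \<le> partition_weight (c ! Suc k)"
    and "\<not> fst (s ! k) \<Longrightarrow> partition_weight (c ! Suc k) \<le> partition_weight (c ! k)"
    and "partition_weight (c ! Suc k) = partition_weight (c ! k) \<Longrightarrow> c ! Suc k = c ! k"
    using horizontal_strip_weight_le by (auto simp: interlace_def split: if_splits) metis+
qed

text \<open>Under these sign conditions every term of the weight is non-negative, and an up step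
  that changes its partition alone costs at least \<open>M\<close>. A lighter walk therefore never
  rises, and being closed it never falls either.\<close>

lemma light_walk_constant:
  assumes c: "c \<in> walks s" and "0 \<le> T" "0 \<le> M"
    and labels: "\<forall>z\<in>set s. if fst z then snd z \<le> - M else 0 \<le> snd z"
    and light: "walk_weight T s c < M"
  shows "c = replicate (length s + 1) (c ! 0)"
proof -
  define D where "D k = int (partition_weight (c ! Suc k)) - int (partition_weight (c ! k))" for k
  have lab: "if fst (s ! k) then snd (s ! k) \<le> - M else 0 \<le> snd (s ! k)" if "k < length s" for k
    using labels that by simp
  have sgn: "if fst (s ! k) then 0 \<le> D k else D k \<le> 0" if "k < length s" for k
    using interlace_weight(1,2)[OF c that] by (simp add: D_def)
  have nonneg: "0 \<le> - snd (s ! k) * D k" if "k < length s" for k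
    using lab[OF that] sgn[OF that] \<open>0 \<le> M\<close>
    by (cases "fst (s ! k)") (auto simp: mult_nonpos_nonneg mult_nonneg_nonpos)
  have wt: "walk_weight T s c = T * int (partition_weight (c ! 0)) + (\<Sum>k<length s. - snd (s ! k) * D k)"
    by (simp add: walk_weight_def D_def sum_negf)
  have D_up: "D k = 0" if "k < length s" "fst (s ! k)" for k
  proof (rule ccontr)
    assume "D k \<noteq> 0"
    then have "1 \<le> D k" "M \<le> - snd (s ! k)"
      using sgn[OF that(1)] lab[OF that(1)] that(2) by auto
    then have "M * 1 \<le> - snd (s ! k) * D k"
      using \<open>0 \<le> M\<close> by (intro mult_mono) auto
    also have "\<dots> \<le> (\<Sum>k<length s. - snd (s ! k) * D k)"
      using that nonneg by (intro member_le_sum) auto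
    also have "\<dots> \<le> walk_weight T s c"
      using \<open>0 \<le> T\<close> wt by simp
    finally show False
      using light by simp
  qed
  then have "D k \<le> 0" if "k < length s" for k
    using sgn[OF that] that by (cases "fst (s ! k)") auto
  \<comment> \<open>The changes telescope to zero because the walk is closed; being non-positive,
    all of them vanish.\<close>
  moreover have "(\<Sum>k<length s. D k) = 0"
    using c sum_lessThan_telescope[of "\<lambda>k. int (partition_weight (c ! k))" "length s"]
    by (simp add: D_def walks_def)
  ultimately have "D k = 0" if "k < length s" for k
    using sum_nonneg_eq_0_iff[of "{..<length s}" "\<lambda>k. - D k"] that by (auto simp: sum_negf)
  then have step: "c ! Suc k = c ! k" if "k < length s" for k
    using interlace_weight(3)[OF c that] that by (simp add: D_def)
  have "c ! k = c ! 0" if "k \<le> length s" for k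
    using that by (induction k) (auto simp: step)
  moreover have len: "length c = length s + 1"
    using c by (simp add: walks_def)
  ultimately have "x = c ! 0" if "x \<in> set c" for x
    using that by (metis add.commute in_set_conv_nth less_Suc_eq_le plus_1_eq_Suc)
  then show "c = replicate (length s + 1) (c ! 0)"
    by (rule replicate_eqI[OF len])
qed


section \<open>Cylindric plane partitions\<close>

text \<open>\<open>Suc k\<close> turns a list index into the one-based position in the profile,
  which is the initial label.\<close>

definition profile_steps :: "bool list \<Rightarrow> (bool \<times> int) list" where
  "profile_steps \<pi> = map (\<lambda>k. (\<pi> ! k, int (Suc k))) [0..<length \<pi>]"

lemma length_profile_steps: "length (profile_steps \<pi>) = length \<pi>"
  by (simp add: profile_steps_def)

lemma sorted_profile_steps: "sorted_wrt (\<lambda>y z. snd y < snd z) (profile_steps \<pi>)"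
  by (auto simp: profile_steps_def sorted_wrt_map sorted_wrt_iff_nth_less)

lemma set_profile_steps:
  "(b, i) \<in> set (profile_steps \<pi>) \<longleftrightarrow> (\<exists>k\<in>{1..length \<pi>}. i = int k \<and> profile_bit \<pi> k = b)"
proof
  assume "(b, i) \<in> set (profile_steps \<pi>)"
  then obtain k where "k < length \<pi>" "b = \<pi> ! k" "i = int (Suc k)"
    by (auto simp: profile_steps_def)
  then show "\<exists>k\<in>{1..length \<pi>}. i = int k \<and> profile_bit \<pi> k = b"
    by (intro bexI[of _ "Suc k"]) (auto simp: profile_bit_def)
next
  assume "\<exists>k\<in>{1..length \<pi>}. i = int k \<and> profile_bit \<pi> k = b"
  then obtain k where "k \<in> {1..length \<pi>}" "i = int k" "profile_bit \<pi> k = b" by blast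
  then show "(b, i) \<in> set (profile_steps \<pi>)"
    by (auto simp: profile_steps_def profile_bit_def image_iff intro!: bexI[of _ "k - 1"])
qed

lemma walks_profile_steps: "walks (profile_steps \<pi>) = CPP \<pi>"
proof -
  have shift: "(\<forall>k\<in>{1..n}. P k) \<longleftrightarrow> (\<forall>k<n. P (Suc k))" for n and P :: "nat \<Rightarrow> bool"
    unfolding image_Suc_lessThan[symmetric] by auto
  show ?thesis
    unfolding walks_def CPP_def shift length_profile_steps
    by (auto simp: profile_steps_def interlace_def profile_bit_def)
qed

lemma walk_weight_profile_steps:
  assumes "c \<in> CPP \<pi>"
  shows "walk_weight (int (length \<pi>)) (profile_steps \<pi>) c = int (CPP_weight \<pi> c)"
proof -
  define a where "a k = int (partition_weight (c ! k))" for k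
  \<comment> \<open>Abel summation. The boundary term cancels the start term of
    \<open>walk_weight\<close>, as first and last partition agree.\<close>
  have by_parts: "(\<Sum>k<n. int (Suc k) * (a (Suc k) - a k)) = int n * a n - (\<Sum>k<n. a k)" for n
    by (induction n) (auto simp: algebra_simps)
  have "(\<Sum>k=1..length \<pi>. a k) = (\<Sum>k<length \<pi>. a (Suc k))"
    unfolding image_Suc_lessThan[symmetric] by (simp add: sum.reindex)
  also have "\<dots> = (\<Sum>k<length \<pi>. a k) + (a (length \<pi>) - a 0)"
    using sum_lessThan_telescope[of a "length \<pi>"] by (simp add: sum_subtractf)
  also have "a (length \<pi>) = a 0"
    using assms by (simp add: CPP_def a_def)
  finally have "int (CPP_weight \<pi> c) = (\<Sum>k<length \<pi>. a k)"
    by (simp add: CPP_weight_def a_def)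
  moreover have "walk_weight (int (length \<pi>)) (profile_steps \<pi>) c
      = int (length \<pi>) * a 0 - (\<Sum>k<length \<pi>. int (Suc k) * (a (Suc k) - a k))"
    unfolding walk_weight_def length_profile_steps a_def
    by (simp add: profile_steps_def)
  ultimately show ?thesis
    using \<open>a (length \<pi>) = a 0\<close> by (simp only: by_parts)
qed

section \<open>Boxes as meetings of an up step with a down step\<close>

definition boxes_upto :: "bool list \<Rightarrow> nat \<Rightarrow> (nat \<times> nat \<times> nat) set" where
  "boxes_upto \<pi> K = {(i, j, k) \<in> boxes \<pi>. k \<le> K}"

text \<open>The box \<open>(i, j, k)\<close> stands for the meeting of up step \<open>i\<close>,
  after \<open>k\<close> trips around the cylinder, with down step \<open>j\<close>.\<close>

definition box_crossing :: "bool list \<Rightarrow> nat \<times> nat \<times> nat \<Rightarrow> int \<times> int" where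
  "box_crossing \<pi> = (\<lambda>(i, j, k). (int i - int k * int (length \<pi>), int j))"

text \<open>Uniqueness of division with remainder, with remainders taken from 1 to \<open>n\<close>:
  a larger \<open>k\<close> would push the value below every value with the smaller one.\<close>

lemma inj_on_box_crossing: "inj_on (box_crossing \<pi>) (boxes \<pi>)"
proof -
  have "k \<le> k'" if "int i - int k * int n = int i' - int k' * int n" "i \<le> n" "1 \<le> i'"
    for i i' k k' n
  proof (rule ccontr)
    assume "\<not> k \<le> k'"
    then have "(int k' + 1) * int n \<le> int k * int n"
      by (intro mult_right_mono) auto
    then show False
      using that by (simp add: algebra_simps)
  qed
  then have "k = k'" if "int i - int k * int n = int i' - int k' * int n"
    "i \<in> {1..n}" "i' \<in> {1..n}" for i i' k k' n
    using that by (metis antisym atLeastAtMost_iff)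
  then have "i = i' \<and> k = k'" if "int i - int k * int n = int i' - int k' * int n"
    "i \<in> {1..n}" "i' \<in> {1..n}" for i i' k k' n
    using that by (metis add_right_cancel diff_add_cancel of_nat_eq_iff)
  then show ?thesis
    by (fastforce simp: inj_on_def box_crossing_def boxes_def)
qed

text \<open>The case distinction in \<open>boxes\<close> amounts to positivity of the hook length;
  \<open>i = j\<close> cannot occur since the bits differ.\<close>

lemma boxes_iff_less:
  assumes "i \<in> {1..length \<pi>}" "j \<in> {1..length \<pi>}" "profile_bit \<pi> i" "\<not> profile_bit \<pi> j"
  shows "(i, j, k) \<in> boxes \<pi> \<longleftrightarrow> int i - int k * int (length \<pi>) < int j"
proof
  assume "(i, j, k) \<in> boxes \<pi>"
  then show "int i - int k * int (length \<pi>) < int j"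
    using int_hook_length[of i j k \<pi>] by linarith
next
  assume "int i - int k * int (length \<pi>) < int j"
  then have "k \<ge> 1" if "i > j"
    using that by (cases k) auto
  then show "(i, j, k) \<in> boxes \<pi>"
    using assms by (auto simp: boxes_def)
qed

lemma box_crossing_image:
  "box_crossing \<pi> ` boxes_upto \<pi> K = crossings (int (length \<pi>)) (profile_steps \<pi>) K"
proof
  show "box_crossing \<pi> ` boxes_upto \<pi> K \<subseteq> crossings (int (length \<pi>)) (profile_steps \<pi>) K"
  proof
    fix x assume "x \<in> box_crossing \<pi> ` boxes_upto \<pi> K"
    then obtain i j k where b: "(i, j, k) \<in> boxes \<pi>" "k \<le> K" "x = box_crossing \<pi> (i, j, k)"
      by (auto simp: boxes_upto_def)
    then have ij: "i \<in> {1..length \<pi>}" "j \<in> {1..length \<pi>}" "profile_bit \<pi> i" "\<not> profile_bit \<pi> j"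
      by (auto simp: boxes_def)
    then have "(True, int i) \<in> set (profile_steps \<pi>)" "(False, int j) \<in> set (profile_steps \<pi>)"
      by (auto simp: set_profile_steps)
    then show "x \<in> crossings (int (length \<pi>)) (profile_steps \<pi>) K"
      using b boxes_iff_less[OF ij] unfolding crossings_def box_crossing_def by auto
  qed
  show "crossings (int (length \<pi>)) (profile_steps \<pi>) K \<subseteq> box_crossing \<pi> ` boxes_upto \<pi> K"
  proof
    fix x assume "x \<in> crossings (int (length \<pi>)) (profile_steps \<pi>) K"
    then obtain i j k where ij: "i \<in> {1..length \<pi>}" "j \<in> {1..length \<pi>}" "profile_bit \<pi> i"
      "\<not> profile_bit \<pi> j" and k: "k \<le> K" "int i - int k * int (length \<pi>) < int j"
      "x = (int i - int k * int (length \<pi>), int j)"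
      unfolding crossings_def set_profile_steps by auto
    then have "(i, j, k) \<in> boxes_upto \<pi> K"
      using boxes_iff_less[OF ij] by (simp add: boxes_upto_def)
    then show "x \<in> box_crossing \<pi> ` boxes_upto \<pi> K"
      using k(3) by (intro image_eqI[of _ _ "(i, j, k)"]) (auto simp: box_crossing_def)
  qed
qed

lemma cross_weight_box_crossing:
  assumes "b \<in> boxes \<pi>"
  shows "cross_weight (box_crossing \<pi> b) = int (hook_length \<pi> b)"
  using assms int_hook_length(1)
  by (cases b) (auto simp: cross_weight_def box_crossing_def simp del: hook_length.simps)

section \<open>Labelled diagrams of bounded weight\<close>

lemma ALCD_eq_labellings: "ALCD \<pi> = labellings (boxes \<pi>)"
  by (simp add: ALCD_def labellings_def)

lemma ALCD_weight_eq:
  assumes "d \<in> ALCD \<pi>"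
  shows "int (ALCD_weight \<pi> d) = label_weight (\<lambda>b. int (hook_length \<pi> b)) d"
proof -
  have "{b. b \<in> boxes \<pi> \<and> d b \<noteq> 0} = {b. d b \<noteq> 0}"
    using assms unfolding ALCD_def by (metis (mono_tags, lifting) mem_Collect_eq neq0_conv)
  then show ?thesis
    by (simp add: ALCD_weight_def label_weight_def)
qed

lemma labellings_mono: "S \<subseteq> S' \<Longrightarrow> labellings S \<subseteq> labellings S'"
  by (auto simp: labellings_def)

text \<open>From \<open>j \<ge> 1\<close> and \<open>i \<le> length \<pi>\<close> the hook length is
  at least \<open>1 + (k - 1) * length \<pi>\<close>.\<close>

lemma hook_length_lower_bound:
  assumes "(i, j, k) \<in> boxes \<pi>" "n + 1 < k"
  shows "n < hook_length \<pi> (i, j, k)"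
proof -
  have ij: "i \<le> length \<pi>" "1 \<le> j" "1 \<le> length \<pi>"
    using assms(1) by (auto simp: boxes_def)
  have "n * 1 \<le> n * length \<pi>"
    using ij by (intro mult_left_mono) auto
  moreover have "(n + 1) * length \<pi> \<le> k * length \<pi>"
    using assms(2) by (intro mult_right_mono) auto
  ultimately show ?thesis
    using ij unfolding hook_length.simps add_mult_distrib by linarith
qed

text \<open>A non-zero label contributes at least its hook length, which bounds the level
  \<open>k\<close> of the box. Finitely many rounds thus produce all the boxes that count in a given
  weight.\<close>

lemma ALCD_light:
  assumes "d \<in> ALCD \<pi>" "ALCD_weight \<pi> d \<le> n"
  shows "d \<in> labellings (boxes_upto \<pi> (n + 1))"
proof -
  have "b \<in> boxes_upto \<pi> (n + 1)" if "d b \<noteq> 0" for b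
  proof -
    obtain i j k where b: "b = (i, j, k)" by (cases b)
    have box: "(i, j, k) \<in> boxes \<pi>"
    proof (rule ccontr)
      assume "(i, j, k) \<notin> boxes \<pi>"
      then have "d b = 0"
        using assms(1) b by (simp add: ALCD_def)
      then show False
        using that by simp
    qed
    have "int (d b) * int (hook_length \<pi> b) \<le> int n"
      using label_le_label_weight(1)[of d "boxes \<pi>" "\<lambda>b. int (hook_length \<pi> b)" b] assms
        ALCD_weight_eq[OF assms(1)] by (simp add: ALCD_eq_labellings)
    then have "d b * hook_length \<pi> b \<le> n"
      by (metis of_nat_le_iff of_nat_mult)
    moreover have "1 * hook_length \<pi> b \<le> d b * hook_length \<pi> b"
      using that by (intro mult_right_mono) auto
    ultimately have "hook_length \<pi> (i, j, k) \<le> n"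
      unfolding b by linarith
    then have "k \<le> n + 1"
      using hook_length_lower_bound[OF box, of n] by (meson leD not_le)
    then show ?thesis
      using box b by (simp add: boxes_upto_def)
  qed
  then show ?thesis
    using assms(1) by (auto simp: ALCD_def labellings_def)
qed

text \<open>After \<open>n + 2\<close> rounds all labels of upward steps lie below \<open>-n\<close>, which leaves only constant
  walks in weight \<open>n\<close>.\<close>

lemma weight_equiv_fibre_CPP:
  assumes "length \<pi> \<ge> 1"
  defines "w \<equiv> \<lambda>(\<gamma>, d). int (length \<pi> * partition_weight \<gamma> + ALCD_weight \<pi> d)"
  shows "weight_equiv {x \<in> IP \<times> ALCD \<pi>. w x = int n} w
    {c \<in> CPP \<pi>. int (CPP_weight \<pi> c) = int n} (\<lambda>c. int (CPP_weight \<pi> c))"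
proof -
  let ?T = "int (length \<pi>)"
  let ?s = "profile_steps \<pi>"
  let ?h = "\<lambda>b. int (hook_length \<pi> b)"
  \<comment> \<open>Labels of up steps drop to at most
    \<open>T - (n + 2) * T = - (n + 1) * T\<close>, and \<open>K\<close> also covers the level
    \<open>n + 1\<close> needed for \<open>ALCD_light\<close>.\<close>
  define K where "K = n + 2"
  define B where "B = boxes_upto \<pi> K"
  define r where "r = downs ?s @ shift_labels (int K * ?T) (ups ?s)"
  define v where "v = (\<lambda>(d, c). label_weight ?h d + walk_weight ?T r c)"
  have labels: "1 \<le> snd z \<and> snd z \<le> ?T" if "z \<in> set ?s" for z
    using that set_profile_steps[of "fst z" "snd z" \<pi>] by auto
  have len_r: "length r = length \<pi>"
  proof -
    have "length (downs ?s) + length (ups ?s) = length ?s"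
      using sum_length_filter_compl[of fst ?s] by (simp add: downs_def ups_def)
    then show ?thesis
      by (simp add: r_def shift_labels_def length_profile_steps)
  qed
  have labels_r: "\<forall>z\<in>set r. if fst z then snd z \<le> - (int n + 1) else 0 \<le> snd z"
  proof
    fix z assume "z \<in> set r"
    then consider "z \<in> set (downs ?s)" | y where "y \<in> set ?s" "fst y" "z = apsnd (\<lambda>z. z - int K * ?T) y"
      by (auto simp: r_def shift_labels_def ups_def)
    then show "if fst z then snd z \<le> - (int n + 1) else 0 \<le> snd z"
    proof cases
      case 1
      then show ?thesis
        using labels[of z] by (auto simp: downs_def)
    next
      case 2
      have "(int n + 1) * 1 \<le> (int n + 1) * ?T"
        using assms(1) by (intro mult_left_mono) auto
      then have "snd z \<le> - (int n + 1)"
        using labels[OF 2(1)] 2(3) by (simp add: K_def algebra_simps)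
      then show ?thesis
        using 2 by simp
    qed
  qed
  have B_sub: "B \<subseteq> boxes \<pi>"
    by (auto simp: B_def boxes_upto_def)
  have light: "c = replicate (length \<pi> + 1) (c ! 0)"
    if "c \<in> walks r" "walk_weight ?T r c < int n + 1" for c
    using light_walk_constant[OF that(1) _ _ labels_r that(2)] len_r by simp
  \<comment> \<open>This chain performs \<open>K\<close> rounds and then renames the recorded pairs
    as boxes of level at most \<open>K\<close>.\<close>
  have "weight_equiv (CPP \<pi>) (\<lambda>c. int (CPP_weight \<pi> c)) (walks ?s) (walk_weight ?T ?s)"
    by (rule weight_equivI[where f = id and g = id])
      (auto simp: walks_profile_steps walk_weight_profile_steps)
  also have "weight_equiv (walks ?s) (walk_weight ?T ?s) (labellings (crossings ?T ?s K) \<times> walks r)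
      (\<lambda>(d, c). label_weight cross_weight d + walk_weight ?T r c)"
    using reduces_rounds[OF sorted_profile_steps, of \<pi> ?T K] labels
    unfolding reduces_def r_def by blast
  also (weight_equiv_trans) have "weight_equiv (labellings (crossings ?T ?s K) \<times> walks r)
      (\<lambda>(d, c). label_weight cross_weight d + walk_weight ?T r c) (labellings B \<times> walks r) v"
    unfolding v_def B_def box_crossing_image[symmetric]
    by (intro weight_equiv_Times weight_equiv_sym[OF weight_equiv_labellings_image] weight_equiv_refl)
      (use B_sub cross_weight_box_crossing in
        \<open>auto simp: B_def intro: inj_on_subset[OF inj_on_box_crossing]\<close>)
  finally (weight_equiv_trans) have "weight_equiv {c \<in> CPP \<pi>. int (CPP_weight \<pi> c) = int n}
      (\<lambda>c. int (CPP_weight \<pi> c)) {y \<in> labellings B \<times> walks r. v y = int n} v"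
    by (rule weight_equiv_fibre)
  \<comment> \<open>In weight \<open>n\<close> the remaining walk is constant and amounts to a
    partition \<open>\<gamma>\<close>, while the boxes outside \<open>B\<close> carry the label
    0.\<close>
  moreover have "weight_equiv {x \<in> IP \<times> ALCD \<pi>. w x = int n} w {y \<in> labellings B \<times> walks r. v y = int n} v"
  proof (rule weight_equivI[where f = "\<lambda>(\<gamma>, d). (d, replicate (length \<pi> + 1) \<gamma>)"
        and g = "\<lambda>(d, c). (c ! 0, d)"])
    fix x assume "x \<in> {x \<in> IP \<times> ALCD \<pi>. w x = int n}"
    then obtain \<gamma> d where x: "x = (\<gamma>, d)" "\<gamma> \<in> IP" "d \<in> ALCD \<pi>" "w x = int n"
      by blast
    have const: "replicate (length \<pi> + 1) \<gamma> \<in> walks r"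
      "walk_weight ?T r (replicate (length \<pi> + 1) \<gamma>) = ?T * int (partition_weight \<gamma>)"
      using walks_replicate(1)[OF x(2), of r] walks_replicate(2)[OF x(2), of ?T r] len_r
      by simp_all
    have "ALCD_weight \<pi> d \<le> n"
      using x(1,4) by (simp add: w_def flip: of_nat_mult of_nat_add)
    then have "d \<in> labellings B"
      using ALCD_light[OF x(3)] labellings_mono[of "boxes_upto \<pi> (n + 1)" B]
      by (auto simp: B_def K_def boxes_upto_def)
    moreover show "v (case x of (\<gamma>, d) \<Rightarrow> (d, replicate (length \<pi> + 1) \<gamma>)) = w x"
      using const(2) ALCD_weight_eq[OF x(3)] x(1) by (simp add: v_def w_def)
    ultimately show "(case x of (\<gamma>, d) \<Rightarrow> (d, replicate (length \<pi> + 1) \<gamma>))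
        \<in> {y \<in> labellings B \<times> walks r. v y = int n}"
      using const(1) x by simp
    show "(case case x of (\<gamma>, d) \<Rightarrow> (d, replicate (length \<pi> + 1) \<gamma>) of (d, c) \<Rightarrow> (c ! 0, d)) = x"
      using x(1) by simp
  next
    fix y assume "y \<in> {y \<in> labellings B \<times> walks r. v y = int n}"
    then obtain d c where y: "y = (d, c)" "d \<in> labellings B" "c \<in> walks r" "v y = int n"
      by blast
    have d: "d \<in> ALCD \<pi>"
      using y(2) B_sub labellings_mono unfolding ALCD_eq_labellings by blast
    have IP: "c ! 0 \<in> IP"
      using y(3) by (auto simp: walks_def subset_iff)
    \<comment> \<open>The labelling has non-negative weight, so the walk weighs at most
      \<open>n\<close> and \<open>light\<close> applies.\<close>
    have "0 \<le> label_weight ?h d"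
      using label_le_label_weight(2)[OF y(2), of ?h] by simp
    then have c: "c = replicate (length \<pi> + 1) (c ! 0)"
      using light[OF y(3)] y(1,4) by (simp add: v_def)
    then have "walk_weight ?T r c = ?T * int (partition_weight (c ! 0))"
      using walks_replicate(2)[OF IP, of ?T r] len_r by simp
    then show "(case y of (d, c) \<Rightarrow> (c ! 0, d)) \<in> {x \<in> IP \<times> ALCD \<pi>. w x = int n}"
      using y(1,4) IP d ALCD_weight_eq[OF d] by (simp add: v_def w_def)
    show "(case case y of (d, c) \<Rightarrow> (c ! 0, d) of (\<gamma>, d) \<Rightarrow> (d, replicate (length \<pi> + 1) \<gamma>)) = y"
      using y(1) c by simp
  qed
  ultimately show ?thesis
    using weight_equiv_sym weight_equiv_trans by blast
qed

theorem theorem1: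
  fixes T :: nat and \<pi> :: "bool list"
  assumes "T \<ge> 1" and "length \<pi> = T"
  shows "\<exists>\<Psi> :: (nat \<Rightarrow> nat) \<times> (nat \<times> nat \<times> nat \<Rightarrow> nat) \<Rightarrow> (nat \<Rightarrow> nat) list.
    bij_betw \<Psi> (IP \<times> ALCD \<pi>) (CPP \<pi>) \<and>
    (\<forall>\<gamma>\<in>IP. \<forall>d\<in>ALCD \<pi>.
       CPP_weight \<pi> (\<Psi> (\<gamma>, d)) = T * partition_weight \<gamma> + ALCD_weight \<pi> d)"
proof -
  let ?w = "\<lambda>(\<gamma>, d). int (length \<pi> * partition_weight \<gamma> + ALCD_weight \<pi> d)"
  let ?v = "\<lambda>c. int (CPP_weight \<pi> c)"
  have "weight_equiv (IP \<times> ALCD \<pi>) ?w (CPP \<pi>) ?v"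
  proof (rule weight_equiv_of_fibres)
    fix n :: int
    show "weight_equiv {x \<in> IP \<times> ALCD \<pi>. ?w x = n} ?w {c \<in> CPP \<pi>. ?v c = n} ?v"
    proof (cases "0 \<le> n")
      case True
      then show ?thesis
        using weight_equiv_fibre_CPP[of \<pi> "nat n"] assms by simp
    next
      \<comment> \<open>Both weights are natural numbers, so negative fibres are empty.\<close>
      case False
      then have "{x \<in> IP \<times> ALCD \<pi>. ?w x = n} = {}" "{c \<in> CPP \<pi>. ?v c = n} = {}"
        by auto
      then show ?thesis
        by (simp only: weight_equiv_empty)
    qed
  qed
  then obtain \<Psi> where bij: "bij_betw \<Psi> (IP \<times> ALCD \<pi>) (CPP \<pi>)"
    and weight: "\<forall>x\<in>IP \<times> ALCD \<pi>. ?v (\<Psi> x) = ?w x"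
    unfolding weight_equiv_def by blast
  have "CPP_weight \<pi> (\<Psi> (\<gamma>, d)) = T * partition_weight \<gamma> + ALCD_weight \<pi> d"
    if "\<gamma> \<in> IP" "d \<in> ALCD \<pi>" for \<gamma> d
    using bspec[OF weight, of "(\<gamma>, d)"] that assms(2)
    by (simp only: prod.case of_nat_eq_iff mem_Sigma_iff simp_thms)
  then show ?thesis
    using bij by blast
qed

end
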